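(* Let $\mathbf{k}$ be a unitary commutative ring and let $\mathfrak{D}$ and $\Omega$ be nonempty sets. Let $\mathrm{DD}_{\mathfrak{D},\Omega}$ be the free $\mathbf{k}$-module on the $\mathfrak{D}$-decorated $\Omega$-typed planar binary trees with at least one internal vertex, with the binary operations $\{\prec_\omega,\succ_\omega\mid\omega\in\Omega\}$ defined recursively in the context. Then $(\mathrm{DD}_{\mathfrak{D},\Omega},\{\prec_\omega,\succ_\omega\mid\omega\in\Omega\})$ is a matching dendriform algebra.
   Context: Trees. Let $e$ be a symbol not in $\Omega$ (the "empty type") and $\mathfrak{T}=\Omega\sqcup\{e\}$. For $n\ge 0$, let $Y_n$ be the set of planar binary rooted trees with $n$ internal vertices (every internal vertex having exactly two inputs, left and right, and one output). Let $Y_{\mathfrak{D},\Omega}(n)$ be the set of trees in $Y_n$ together with a decoration of each internal vertex by an element of $\mathfrak{D}$, of each internal edge (edge joining two internal vertices) by an element of $\Omega$, and of each leaf edge (other than the root edge) by $e$. $Y_{\mathfrak{D},\Omega}(0)=\{|\}$, where $|$ is the tree with no internal vertex. Set $\mathrm{DD}_{\mathfrak{D},\Omega}=\bigoplus_{n\ge1}\mathbf{k}Y_{\mathfrak{D},\Omega}(n)$. Grafting. For trees $T,T'$, $d\in\mathfrak{D}$ and $t_1,t_2\in\mathfrak{T}$ (with $t_1=e$ if and only if $T=|$, and $t_2=e$ if and only if $T'=|$), $T\vee_{d,t_1,t_2}T'$ is the tree obtained by joining the roots of $T$ (left) and $T'$ (right) to a new root vertex decorated by $d$, with the new left edge decorated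 by $t_1$ and the new right edge decorated by $t_2$. Every tree $T$ with at least one internal vertex is uniquely of the form $T=T^l\vee_{d,t_1,t_2}T^r$. Grafting is extended bilinearly (in particular $0\vee_{d,t_1,t_2}T'=T\vee_{d,t_1,t_2}0=0$, whatever the types). Operations. $\prec_\omega,\succ_\omega$ on $\mathrm{DD}_{\mathfrak{D},\Omega}$ are bilinear and defined on trees by recursion on depth: (1) For every tree $T$ with at least one internal vertex and every $\omega\in\Omega\sqcup\{e\}$: $|\succ_\omega T=T\prec_\omega|=T$ and $|\prec_\omega T=T\succ_\omega|=0$. (2) For $T=T^l\vee_{a,\alpha,\beta}T^r$, $U=U^l\vee_{b,\gamma,\delta}U^r$ and $\omega\in\Omega$: $$T\prec_\omega U:=T^l\vee_{a,\alpha,\beta}(T^r\prec_\omega U)+T^l\vee_{a,\alpha,\omega}(T^r\succ_\beta U),$$ $$T\succ_\omega U:=(T\prec_\gamma U^l)\vee_{b,\omega,\delta}U^r+(T\succ_\omega U^l)\vee_{b,\gamma,\delta}U^r.$$ (If $\beta=e$ then $T^r=|$, and if $\gamma=e$ then $U^l=|$, so operations indexed by $e$ only occur through rule (1).) A matching dendriform algebra is a $\mathbf{k}$-module $D$ with bilinear operations $\{\prec_\omega,\succ_\omega\mid\omega\in\Omega\}$ such that for all $x,y,z\in D$ and $\alpha,\beta\in\Omega$: $$(x\prec_\alpha y)\prec_\beta z=x\prec_\alpha(y\prec_\beta z)+x\prec_\beta(y\succ_\alpha z),$$ $$(x\succ_\alpha y)\prec_\beta z=x\succ_\alpha(y\prec_\beta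 z),$$ $$(x\prec_\beta y)\succ_\alpha z+(x\succ_\alpha y)\succ_\beta z=x\succ_\alpha(y\succ_\beta z).$$ *)

theory Defs
  imports "HOL-Library.Poly_Mapping"
begin

text \<open>
  The empty type \<open>e\<close> is \<^term>\<open>None\<close>, so the set of edge types \<open>\<Omega> \<squnion> {e}\<close> is \<^typ>\<open>'w option\<close>.
  \<open>Node T t1 d t2 T'\<close> is the grafting of \<open>T\<close> and \<open>T'\<close> on a new root vertex decorated by \<open>d\<close>,
  with the new left and right edges decorated by \<open>t1\<close> and \<open>t2\<close>.
\<close>

datatype ('d, 'w) tree =
    Leaf
  | Node "('d, 'w) tree" "'w option" 'd "'w option" "('d, 'w) tree"

primrec vertices :: "('d, 'w) tree \<Rightarrow> nat" where
  "vertices Leaf = 0"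
| "vertices (Node T t1 d t2 T') = vertices T + vertices T' + 1"

primrec well_typed :: "('d, 'w) tree \<Rightarrow> bool" where
  "well_typed Leaf \<longleftrightarrow> True"
| "well_typed (Node T t1 d t2 T') \<longleftrightarrow>
     (t1 = None \<longleftrightarrow> T = Leaf) \<and> (t2 = None \<longleftrightarrow> T' = Leaf) \<and> well_typed T \<and> well_typed T'"

definition Y :: "nat \<Rightarrow> ('d, 'w) tree set" where
  "Y n = {T. well_typed T \<and> vertices T = n}"

text \<open>
  The sort \<open>{comm_ring, comm_monoid_mult}\<close> is that of unitary commutative rings, the zero ring
  included; \<^class>\<open>comm_ring_1\<close> (and hence the library locale \<open>module\<close>) would exclude the
  zero ring.
\<close>

definition scale :: "'k::{comm_ring, comm_monoid_mult} \<Rightarrow> ('a \<Rightarrow>\<^sub>0 'k) \<Rightarrow> ('a \<Rightarrow>\<^sub>0 'k)" where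
  "scale c p = Poly_Mapping.map ((*) c) p"

definition DD :: "(('d, 'w) tree \<Rightarrow>\<^sub>0 'k::{comm_ring, comm_monoid_mult}) set" where
  "DD = {p. Poly_Mapping.keys p \<subseteq> (\<Union>n\<in>{1..}. Y n)}"

definition bilinear_ext ::
  "('a \<Rightarrow> 'b \<Rightarrow> ('c \<Rightarrow>\<^sub>0 'k)) \<Rightarrow> ('a \<Rightarrow>\<^sub>0 'k) \<Rightarrow> ('b \<Rightarrow>\<^sub>0 'k)
    \<Rightarrow> ('c \<Rightarrow>\<^sub>0 'k::{comm_ring, comm_monoid_mult})" where
  "bilinear_ext f p q =
     (\<Sum>s\<in>Poly_Mapping.keys p. \<Sum>t\<in>Poly_Mapping.keys q.
        scale (Poly_Mapping.lookup p s * Poly_Mapping.lookup q t) (f s t))"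

abbreviation basis :: "'a \<Rightarrow> ('a \<Rightarrow>\<^sub>0 'k::{comm_ring, comm_monoid_mult})" where
  "basis T \<equiv> Poly_Mapping.single T 1"

definition graft ::
  "(('d, 'w) tree \<Rightarrow>\<^sub>0 'k) \<Rightarrow> 'w option \<Rightarrow> 'd \<Rightarrow> 'w option \<Rightarrow> (('d, 'w) tree \<Rightarrow>\<^sub>0 'k)
    \<Rightarrow> (('d, 'w) tree \<Rightarrow>\<^sub>0 'k::{comm_ring, comm_monoid_mult})" where
  "graft p t1 d t2 q = bilinear_ext (\<lambda>T T'. basis (Node T t1 d t2 T')) p q"

text \<open>
  The operations on trees. Only the following values are conventions for totality: those on a
  pair of leaves, and those of an operation of type \<^term>\<open>None\<close> on two trees that are not leaves.
  Neither is reached from well-typed trees with at least one vertex and a type in \<open>\<Omega>\<close>.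
\<close>

fun tree_prec :: "'w option \<Rightarrow> ('d, 'w) tree \<Rightarrow> ('d, 'w) tree
      \<Rightarrow> (('d, 'w) tree \<Rightarrow>\<^sub>0 'k::{comm_ring, comm_monoid_mult})"
  and tree_succ :: "'w option \<Rightarrow> ('d, 'w) tree \<Rightarrow> ('d, 'w) tree
      \<Rightarrow> (('d, 'w) tree \<Rightarrow>\<^sub>0 'k::{comm_ring, comm_monoid_mult})"
where
  "tree_prec \<omega> Leaf U = 0"
| "tree_prec \<omega> (Node Tl \<alpha> a \<beta> Tr) Leaf = basis (Node Tl \<alpha> a \<beta> Tr)"
| "tree_prec \<omega> (Node Tl \<alpha> a \<beta> Tr) (Node Ul \<gamma> b \<delta> Ur) =
     graft (basis Tl) \<alpha> a \<beta> (tree_prec \<omega> Tr (Node Ul \<gamma> b \<delta> Ur)) +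
     graft (basis Tl) \<alpha> a \<omega> (tree_succ \<beta> Tr (Node Ul \<gamma> b \<delta> Ur))"
| "tree_succ \<omega> T Leaf = 0"
| "tree_succ \<omega> Leaf (Node Ul \<gamma> b \<delta> Ur) = basis (Node Ul \<gamma> b \<delta> Ur)"
| "tree_succ \<omega> (Node Tl \<alpha> a \<beta> Tr) (Node Ul \<gamma> b \<delta> Ur) =
     graft (tree_prec \<gamma> (Node Tl \<alpha> a \<beta> Tr) Ul) \<omega> b \<delta> (basis Ur) +
     graft (tree_succ \<omega> (Node Tl \<alpha> a \<beta> Tr) Ul) \<gamma> b \<delta> (basis Ur)"

definition dd_prec :: "(('d, 'w) tree \<Rightarrow>\<^sub>0 'k) \<Rightarrow> 'w \<Rightarrow> (('d, 'w) tree \<Rightarrow>\<^sub>0 'k)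
    \<Rightarrow> (('d, 'w) tree \<Rightarrow>\<^sub>0 'k::{comm_ring, comm_monoid_mult})" where
  "dd_prec x \<omega> y = bilinear_ext (tree_prec (Some \<omega>)) x y"

definition dd_succ :: "(('d, 'w) tree \<Rightarrow>\<^sub>0 'k) \<Rightarrow> 'w \<Rightarrow> (('d, 'w) tree \<Rightarrow>\<^sub>0 'k)
    \<Rightarrow> (('d, 'w) tree \<Rightarrow>\<^sub>0 'k::{comm_ring, comm_monoid_mult})" where
  "dd_succ x \<omega> y = bilinear_ext (tree_succ (Some \<omega>)) x y"

text \<open>
  The module is a carrier set \<open>D\<close> whose addition and zero are those of the ambient group
  \<^typ>\<open>'m\<close>; closure under negation follows from closure under scaling by \<open>-1\<close>.
\<close>

locale matching_dendriform_algebra =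
  fixes D :: "'m::ab_group_add set"
    and smult :: "'k::{comm_ring, comm_monoid_mult} \<Rightarrow> 'm \<Rightarrow> 'm"  (infixr \<open>\<cdot>\<close> 75)
    and prec :: "'m \<Rightarrow> 'w \<Rightarrow> 'm \<Rightarrow> 'm"  (\<open>(_ \<prec>\<^bsub>_\<^esub> _)\<close> [71, 0, 71] 70)
    and succ :: "'m \<Rightarrow> 'w \<Rightarrow> 'm \<Rightarrow> 'm"  (\<open>(_ \<succ>\<^bsub>_\<^esub> _)\<close> [71, 0, 71] 70)
  assumes zero_closed: "0 \<in> D"
    and add_closed: "\<lbrakk>x \<in> D; y \<in> D\<rbrakk> \<Longrightarrow> x + y \<in> D"
    and smult_closed: "x \<in> D \<Longrightarrow> c \<cdot> x \<in> D"
    and smult_add_right: "\<lbrakk>x \<in> D; y \<in> D\<rbrakk> \<Longrightarrow> c \<cdot> (x + y) = c \<cdot> x + c \<cdot> y"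
    and smult_add_left: "x \<in> D \<Longrightarrow> (c + c') \<cdot> x = c \<cdot> x + c' \<cdot> x"
    and smult_smult: "x \<in> D \<Longrightarrow> c \<cdot> (c' \<cdot> x) = (c * c') \<cdot> x"
    and smult_one: "x \<in> D \<Longrightarrow> 1 \<cdot> x = x"
    and prec_closed: "\<lbrakk>x \<in> D; y \<in> D\<rbrakk> \<Longrightarrow> x \<prec>\<^bsub>\<alpha>\<^esub> y \<in> D"
    and prec_add_left: "\<lbrakk>x \<in> D; x' \<in> D; y \<in> D\<rbrakk> \<Longrightarrow> (x + x') \<prec>\<^bsub>\<alpha>\<^esub> y = x \<prec>\<^bsub>\<alpha>\<^esub> y + x' \<prec>\<^bsub>\<alpha>\<^esub> y"
    and prec_add_right: "\<lbrakk>x \<in> D; y \<in> D; y' \<in> D\<rbrakk> \<Longrightarrow> x \<prec>\<^bsub>\<alpha>\<^esub> (y + y') = x \<prec>\<^bsub>\<alpha>\<^esub> y + x \<prec>\<^bsub>\<alpha>\<^esub> y'"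
    and prec_smult_left: "\<lbrakk>x \<in> D; y \<in> D\<rbrakk> \<Longrightarrow> (c \<cdot> x) \<prec>\<^bsub>\<alpha>\<^esub> y = c \<cdot> (x \<prec>\<^bsub>\<alpha>\<^esub> y)"
    and prec_smult_right: "\<lbrakk>x \<in> D; y \<in> D\<rbrakk> \<Longrightarrow> x \<prec>\<^bsub>\<alpha>\<^esub> (c \<cdot> y) = c \<cdot> (x \<prec>\<^bsub>\<alpha>\<^esub> y)"
    and succ_closed: "\<lbrakk>x \<in> D; y \<in> D\<rbrakk> \<Longrightarrow> x \<succ>\<^bsub>\<alpha>\<^esub> y \<in> D"
    and succ_add_left: "\<lbrakk>x \<in> D; x' \<in> D; y \<in> D\<rbrakk> \<Longrightarrow> (x + x') \<succ>\<^bsub>\<alpha>\<^esub> y = x \<succ>\<^bsub>\<alpha>\<^esub> y + x' \<succ>\<^bsub>\<alpha>\<^esub> y"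
    and succ_add_right: "\<lbrakk>x \<in> D; y \<in> D; y' \<in> D\<rbrakk> \<Longrightarrow> x \<succ>\<^bsub>\<alpha>\<^esub> (y + y') = x \<succ>\<^bsub>\<alpha>\<^esub> y + x \<succ>\<^bsub>\<alpha>\<^esub> y'"
    and succ_smult_left: "\<lbrakk>x \<in> D; y \<in> D\<rbrakk> \<Longrightarrow> (c \<cdot> x) \<succ>\<^bsub>\<alpha>\<^esub> y = c \<cdot> (x \<succ>\<^bsub>\<alpha>\<^esub> y)"
    and succ_smult_right: "\<lbrakk>x \<in> D; y \<in> D\<rbrakk> \<Longrightarrow> x \<succ>\<^bsub>\<alpha>\<^esub> (c \<cdot> y) = c \<cdot> (x \<succ>\<^bsub>\<alpha>\<^esub> y)"
    and prec_prec: "\<lbrakk>x \<in> D; y \<in> D; z \<in> D\<rbrakk> \<Longrightarrow>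
      (x \<prec>\<^bsub>\<alpha>\<^esub> y) \<prec>\<^bsub>\<beta>\<^esub> z = x \<prec>\<^bsub>\<alpha>\<^esub> (y \<prec>\<^bsub>\<beta>\<^esub> z) + x \<prec>\<^bsub>\<beta>\<^esub> (y \<succ>\<^bsub>\<alpha>\<^esub> z)"
    and succ_prec: "\<lbrakk>x \<in> D; y \<in> D; z \<in> D\<rbrakk> \<Longrightarrow>
      (x \<succ>\<^bsub>\<alpha>\<^esub> y) \<prec>\<^bsub>\<beta>\<^esub> z = x \<succ>\<^bsub>\<alpha>\<^esub> (y \<prec>\<^bsub>\<beta>\<^esub> z)"
    and succ_succ: "\<lbrakk>x \<in> D; y \<in> D; z \<in> D\<rbrakk> \<Longrightarrow>
      (x \<prec>\<^bsub>\<beta>\<^esub> y) \<succ>\<^bsub>\<alpha>\<^esub> z + (x \<succ>\<^bsub>\<alpha>\<^esub> y) \<succ>\<^bsub>\<beta>\<^esub> z = x \<succ>\<^bsub>\<alpha>\<^esub> (y \<succ>\<^bsub>\<beta>\<^esub> z)"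

end

theory Submission
  imports Defs
begin

text \<open>
  Extend the operations bilinearly to all trees, the single vertex-free tree included, and to all
  types. Then the three axioms hold for any types as soon as the middle tree is not a leaf, with no
  assumption of well-typedness: expanding the left factor in the first axiom (the right factor in
  the third) by the recursion and comparing terms reduces it to instances of all three axioms in
  which this factor is replaced by its right (left) subtree, while the second axiom is a direct
  computation. So induct on the total size of the two outer trees; the rules for \<open>|\<close> start the
  induction.
\<close>

section \<open>Bilinear extension\<close>

lemma lookup_scale: "Poly_Mapping.lookup (scale c p) k = c * Poly_Mapping.lookup p k"
  by (simp add: scale_def Poly_Mapping.map.rep_eq when_def)

lemma scale_zero_left [simp]: "scale 0 p = 0"
  and scale_zero_right [simp]: "scale c 0 = 0"
  and scale_one [simp]: "scale 1 p = p"
  and scale_scale [simp]: "scale c (scale c' p) = scale (c * c') p"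
  and scale_add_right: "scale c (p + q) = scale c p + scale c q"
  and scale_add_left: "scale (c + c') p = scale c p + scale c' p"
  by (rule poly_mapping_eqI, simp add: lookup_scale lookup_add algebra_simps)+

lemma scale_single: "scale c (Poly_Mapping.single s d) = Poly_Mapping.single s (c * d)"
  by (rule poly_mapping_eqI) (simp add: lookup_scale lookup_single when_def)

lemma scale_sum: "scale c (\<Sum>i\<in>I. f i) = (\<Sum>i\<in>I. scale c (f i))"
  by (induction I rule: infinite_finite_induct) (simp_all add: scale_add_right)

lemma keys_scale_subset: "Poly_Mapping.keys (scale c p) \<subseteq> Poly_Mapping.keys p"
  by (auto simp: in_keys_iff lookup_scale)

text \<open>Terms outside the keys have coefficient 0. Since a sum or a scalar multiple may lose
  keys through cancellation or zero divisors, the linearity laws are proved over a common larger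
  index set.\<close>

lemma bilinear_ext_supersets:
  assumes "finite A" "finite B" "Poly_Mapping.keys p \<subseteq> A" "Poly_Mapping.keys q \<subseteq> B"
  shows "bilinear_ext f p q = (\<Sum>s\<in>A. \<Sum>t\<in>B.
    scale (Poly_Mapping.lookup p s * Poly_Mapping.lookup q t) (f s t))"
proof -
  have "bilinear_ext f p q = (\<Sum>s\<in>Poly_Mapping.keys p. \<Sum>t\<in>B.
    scale (Poly_Mapping.lookup p s * Poly_Mapping.lookup q t) (f s t))"
    unfolding bilinear_ext_def using assms
    by (intro sum.cong[OF refl] sum.mono_neutral_left) (auto simp: in_keys_iff)
  also have "\<dots> = (\<Sum>s\<in>A. \<Sum>t\<in>B.
    scale (Poly_Mapping.lookup p s * Poly_Mapping.lookup q t) (f s t))"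
    using assms by (intro sum.mono_neutral_left) (auto simp: in_keys_iff)
  finally show ?thesis .
qed

lemma bilinear_ext_zero_left [simp]: "bilinear_ext f 0 q = 0"
  and bilinear_ext_zero_right [simp]: "bilinear_ext f p 0 = 0"
  by (simp_all add: bilinear_ext_def)

lemma bilinear_ext_add_left: "bilinear_ext f (p + p') q = bilinear_ext f p q + bilinear_ext f p' q"
proof -
  let ?A = "Poly_Mapping.keys p \<union> Poly_Mapping.keys p'"
  have "Poly_Mapping.keys (p + p') \<subseteq> ?A" by (rule Poly_Mapping.keys_add)
  then show ?thesis
    by (simp add: bilinear_ext_supersets[of ?A "Poly_Mapping.keys q"] lookup_add algebra_simps
        scale_add_left sum.distrib)
qed

lemma bilinear_ext_add_right: "bilinear_ext f p (q + q') = bilinear_ext f p q + bilinear_ext f p q'"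
proof -
  let ?B = "Poly_Mapping.keys q \<union> Poly_Mapping.keys q'"
  have "Poly_Mapping.keys (q + q') \<subseteq> ?B" by (rule Poly_Mapping.keys_add)
  then show ?thesis
    by (simp add: bilinear_ext_supersets[of "Poly_Mapping.keys p" ?B] lookup_add algebra_simps
        scale_add_left sum.distrib)
qed

lemma bilinear_ext_scale_left: "bilinear_ext f (scale c p) q = scale c (bilinear_ext f p q)"
  using keys_scale_subset[of c p]
  by (simp add: bilinear_ext_supersets[of "Poly_Mapping.keys p" "Poly_Mapping.keys q"]
      lookup_scale scale_sum mult.assoc)

lemma bilinear_ext_scale_right: "bilinear_ext f p (scale c q) = scale c (bilinear_ext f p q)"
  using keys_scale_subset[of c q]
  by (simp add: bilinear_ext_supersets[of "Poly_Mapping.keys p" "Poly_Mapping.keys q"]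
      lookup_scale scale_sum mult.left_commute)

lemmas bilinear_ext_linear =
  bilinear_ext_add_left bilinear_ext_add_right bilinear_ext_scale_left bilinear_ext_scale_right

text \<open>Summing over \<open>{s}\<close> and \<open>{t}\<close> also covers the zero ring, where
  basis elements are 0 and have no keys.\<close>

lemma bilinear_ext_basis [simp]: "bilinear_ext f (basis s) (basis t) = f s t"
  by (simp add: bilinear_ext_supersets[of "{s}" "{t}"])

lemma keys_sum_subset:
  assumes "\<And>i. i \<in> I \<Longrightarrow> Poly_Mapping.keys (f i) \<subseteq> C"
  shows "Poly_Mapping.keys (\<Sum>i\<in>I. f i) \<subseteq> C"
  using Poly_Mapping.keys_sum[of f I] assms by blast

lemma keys_bilinear_ext:
  assumes "\<And>s t. s \<in> Poly_Mapping.keys p \<Longrightarrow> t \<in> Poly_Mapping.keys q \<Longrightarrow>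
    Poly_Mapping.keys (f s t) \<subseteq> C"
  shows "Poly_Mapping.keys (bilinear_ext f p q) \<subseteq> C"
  unfolding bilinear_ext_def
  by (intro keys_sum_subset order.trans[OF keys_scale_subset] assms)

definition linear_map ::
  "(('a \<Rightarrow>\<^sub>0 'k::{comm_ring, comm_monoid_mult}) \<Rightarrow> ('b \<Rightarrow>\<^sub>0 'k)) \<Rightarrow> bool" where
  "linear_map F \<longleftrightarrow> (\<forall>p q. F (p + q) = F p + F q) \<and> (\<forall>c p. F (scale c p) = scale c (F p))"

text \<open>Agreement is required only on the keys of \<open>p\<close>, so a condition on the
  support, such as the absence of leaves, is available when the basis elements are compared.\<close>

lemma linear_map_eqI:
  assumes F: "linear_map F" and G: "linear_map G"
    and eq: "\<And>s. s \<in> Poly_Mapping.keys p \<Longrightarrow> F (basis s) = G (basis s)"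
  shows "F p = G p"
proof -
  have expand: "L p = (\<Sum>s\<in>Poly_Mapping.keys p. scale (Poly_Mapping.lookup p s) (L (basis s)))"
    if L: "linear_map L" for L :: "_ \<Rightarrow> 'c \<Rightarrow>\<^sub>0 _"
  proof -
    have "L (scale 0 0) = scale 0 (L 0)" using L unfolding linear_map_def by blast
    then have zero: "L 0 = 0" by simp
    have sum: "L (\<Sum>i\<in>I. g i) = (\<Sum>i\<in>I. L (g i))" for I and g :: "'a \<Rightarrow> _"
      using L by (induction I rule: infinite_finite_induct) (simp_all add: zero linear_map_def)
    have "p = (\<Sum>s\<in>Poly_Mapping.keys p. scale (Poly_Mapping.lookup p s) (basis s))"
      by (rule poly_mapping_eqI)
        (simp add: scale_single lookup_sum lookup_single when_def in_keys_iff)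
    then have "L p = L (\<Sum>s\<in>Poly_Mapping.keys p. scale (Poly_Mapping.lookup p s) (basis s))"
      by (rule arg_cong)
    also have "\<dots> = (\<Sum>s\<in>Poly_Mapping.keys p. scale (Poly_Mapping.lookup p s) (L (basis s)))"
      using L by (simp add: sum linear_map_def)
    finally show ?thesis .
  qed
  show ?thesis
    unfolding expand[OF F] expand[OF G] by (intro sum.cong refl) (simp only: eq)
qed

text \<open>The arguments are replaced by basis elements one at a time, the other two being held
  fixed. This reduces each axiom to trees.\<close>

lemma trilinear_eqI:
  assumes "\<And>y z. linear_map (\<lambda>x. F x y z)" "\<And>x z. linear_map (\<lambda>y. F x y z)"
    and "\<And>x y. linear_map (\<lambda>z. F x y z)"
    and "\<And>y z. linear_map (\<lambda>x. G x y z)" "\<And>x z. linear_map (\<lambda>y. G x y z)"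
    and "\<And>x y. linear_map (\<lambda>z. G x y z)"
    and "\<And>r s t. \<lbrakk>r \<in> Poly_Mapping.keys x; s \<in> Poly_Mapping.keys y; t \<in> Poly_Mapping.keys z\<rbrakk> \<Longrightarrow>
      F (basis r) (basis s) (basis t) = G (basis r) (basis s) (basis t)"
  shows "F x y z = G x y z"
proof (rule linear_map_eqI[OF assms(1,4)])
  fix r assume r: "r \<in> Poly_Mapping.keys x"
  show "F (basis r) y z = G (basis r) y z"
  proof (rule linear_map_eqI[OF assms(2,5)])
    fix s assume s: "s \<in> Poly_Mapping.keys y"
    show "F (basis r) (basis s) z = G (basis r) (basis s) z"
      by (rule linear_map_eqI[OF assms(3,6)]) (rule assms(7)[OF r s])
  qed
qed

section \<open>The operations on linear combinations of arbitrary trees\<close>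

abbreviation prec_ext ::
  "'w option \<Rightarrow> (('d, 'w) tree \<Rightarrow>\<^sub>0 'k) \<Rightarrow> (('d, 'w) tree \<Rightarrow>\<^sub>0 'k)
    \<Rightarrow> (('d, 'w) tree \<Rightarrow>\<^sub>0 'k::{comm_ring, comm_monoid_mult})" where
  "prec_ext \<omega> \<equiv> bilinear_ext (tree_prec \<omega>)"

abbreviation succ_ext ::
  "'w option \<Rightarrow> (('d, 'w) tree \<Rightarrow>\<^sub>0 'k) \<Rightarrow> (('d, 'w) tree \<Rightarrow>\<^sub>0 'k)
    \<Rightarrow> (('d, 'w) tree \<Rightarrow>\<^sub>0 'k::{comm_ring, comm_monoid_mult})" where
  "succ_ext \<omega> \<equiv> bilinear_ext (tree_succ \<omega>)"

lemma graft_basis [simp]: "graft (basis T) \<alpha> a \<beta> (basis U) = basis (Node T \<alpha> a \<beta> U)"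
  by (simp add: graft_def)

lemma graft_zero_left [simp]: "graft 0 \<alpha> a \<beta> y = 0"
  and graft_zero_right [simp]: "graft x \<alpha> a \<beta> 0 = 0"
  by (simp_all add: graft_def)

lemma graft_linear:
  "graft (x + x') \<alpha> a \<beta> y = graft x \<alpha> a \<beta> y + graft x' \<alpha> a \<beta> y"
  "graft x \<alpha> a \<beta> (y + y') = graft x \<alpha> a \<beta> y + graft x \<alpha> a \<beta> y'"
  "graft (scale c x) \<alpha> a \<beta> y = scale c (graft x \<alpha> a \<beta> y)"
  "graft x \<alpha> a \<beta> (scale c y) = scale c (graft x \<alpha> a \<beta> y)"
  by (simp_all add: graft_def bilinear_ext_linear)

lemma keys_basis_subset: "Poly_Mapping.keys (basis s) \<subseteq> {s}"
  by simp

lemma keys_graft: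
  assumes "\<And>T U. T \<in> Poly_Mapping.keys x \<Longrightarrow> U \<in> Poly_Mapping.keys y \<Longrightarrow> Node T \<alpha> a \<beta> U \<in> C"
  shows "Poly_Mapping.keys (graft x \<alpha> a \<beta> y) \<subseteq> C"
  unfolding graft_def
  by (intro keys_bilinear_ext order.trans[OF keys_basis_subset]) (auto intro: assms)

lemma Leaf_notin_keys_graft: "Leaf \<notin> Poly_Mapping.keys (graft x \<alpha> a \<beta> y)"
  using keys_graft[of x y \<alpha> a \<beta> "- {Leaf}"] by auto

text \<open>Every value is 0, a tree with a root vertex, or a sum of two grafts. Hence the rules for
  a leaf next to a leaf-free element apply to all products.\<close>

lemma Leaf_notin_keys_tree_prec: "Leaf \<notin> Poly_Mapping.keys (tree_prec \<omega> T U)"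
  and Leaf_notin_keys_tree_succ: "Leaf \<notin> Poly_Mapping.keys (tree_succ \<omega> T U)"
  by (cases T; cases U;
      auto simp: Leaf_notin_keys_graft dest!: subsetD[OF Poly_Mapping.keys_add] split: if_splits)+

lemma Leaf_notin_keys_prec_ext [simp]: "Leaf \<notin> Poly_Mapping.keys (prec_ext \<omega> x y)"
  using keys_bilinear_ext[of x y "tree_prec \<omega>" "- {Leaf}"] Leaf_notin_keys_tree_prec by blast

lemma Leaf_notin_keys_succ_ext [simp]: "Leaf \<notin> Poly_Mapping.keys (succ_ext \<omega> x y)"
  using keys_bilinear_ext[of x y "tree_succ \<omega>" "- {Leaf}"] Leaf_notin_keys_tree_succ by blast

lemma prec_ext_Leaf_left [simp]: "prec_ext \<omega> (basis Leaf) y = 0"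
  and succ_ext_Leaf_right [simp]: "succ_ext \<omega> x (basis Leaf) = 0"
proof -
  show "prec_ext \<omega> (basis Leaf) y = 0"
    by (rule linear_map_eqI) (simp_all add: linear_map_def bilinear_ext_linear)
  show "succ_ext \<omega> x (basis Leaf) = 0"
    by (rule linear_map_eqI) (simp_all add: linear_map_def bilinear_ext_linear)
qed

lemma tree_prec_Leaf_right: "T \<noteq> Leaf \<Longrightarrow> tree_prec \<omega> T Leaf = basis T"
  by (cases T) simp_all

lemma tree_succ_Leaf_left: "U \<noteq> Leaf \<Longrightarrow> tree_succ \<omega> Leaf U = basis U"
  by (cases U) simp_all

text \<open>The hypothesis keeps away the pair of leaves, on which the operation is 0 by
  convention.\<close>

lemma prec_ext_Leaf_right [simp]:
  assumes "Leaf \<notin> Poly_Mapping.keys x"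
  shows "prec_ext \<omega> x (basis Leaf) = x"
proof (rule linear_map_eqI)
  fix s assume "s \<in> Poly_Mapping.keys x"
  then show "prec_ext \<omega> (basis s) (basis Leaf) = basis s"
    using assms by (simp, metis tree_prec_Leaf_right)
qed (simp_all add: linear_map_def bilinear_ext_linear)

lemma succ_ext_Leaf_left [simp]:
  assumes "Leaf \<notin> Poly_Mapping.keys y"
  shows "succ_ext \<omega> (basis Leaf) y = y"
proof (rule linear_map_eqI)
  fix s assume "s \<in> Poly_Mapping.keys y"
  then show "succ_ext \<omega> (basis Leaf) (basis s) = basis s"
    using assms by (simp, metis tree_succ_Leaf_left)
qed (simp_all add: linear_map_def bilinear_ext_linear)

text \<open>By linearity this is the recursive equation for trees. Leaves are allowed in
  \<open>y\<close> but not in \<open>z\<close>: for \<open>y\<close> and \<open>z\<close> both equal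
  to \<open>basis Leaf\<close>, the left side would be the graft itself and the right side
  0.\<close>

lemma prec_ext_graft:
  assumes "Leaf \<notin> Poly_Mapping.keys z"
  shows "prec_ext \<omega> (graft x \<alpha> a \<beta> y) z =
    graft x \<alpha> a \<beta> (prec_ext \<omega> y z) + graft x \<alpha> a \<omega> (succ_ext \<beta> y z)"
proof (rule trilinear_eqI[where F = "\<lambda>x y z. prec_ext \<omega> (graft x \<alpha> a \<beta> y) z"
      and G = "\<lambda>x y z. graft x \<alpha> a \<beta> (prec_ext \<omega> y z) + graft x \<alpha> a \<omega> (succ_ext \<beta> y z)"])
  fix r s t assume "t \<in> Poly_Mapping.keys z"
  then obtain V1 v1 v v2 V2 where "t = Node V1 v1 v v2 V2"
    using assms by (cases t) auto
  then show "prec_ext \<omega> (graft (basis r) \<alpha> a \<beta> (basis s)) (basis t) =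
    graft (basis r) \<alpha> a \<beta> (prec_ext \<omega> (basis s) (basis t)) +
    graft (basis r) \<alpha> a \<omega> (succ_ext \<beta> (basis s) (basis t))"
    by simp
qed (simp_all add: linear_map_def bilinear_ext_linear graft_linear scale_add_right add_ac)

lemma succ_ext_graft:
  assumes "Leaf \<notin> Poly_Mapping.keys x"
  shows "succ_ext \<omega> x (graft y \<gamma> b \<delta> z) =
    graft (prec_ext \<gamma> x y) \<omega> b \<delta> z + graft (succ_ext \<omega> x y) \<gamma> b \<delta> z"
proof (rule trilinear_eqI[where F = "\<lambda>x y z. succ_ext \<omega> x (graft y \<gamma> b \<delta> z)"
      and G = "\<lambda>x y z. graft (prec_ext \<gamma> x y) \<omega> b \<delta> z + graft (succ_ext \<omega> x y) \<gamma> b \<delta> z"])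
  fix r s t assume "r \<in> Poly_Mapping.keys x"
  then obtain T1 t1 t' t2 T2 where "r = Node T1 t1 t' t2 T2"
    using assms by (cases r) auto
  then show "succ_ext \<omega> (basis r) (graft (basis s) \<gamma> b \<delta> (basis t)) =
    graft (prec_ext \<gamma> (basis r) (basis s)) \<omega> b \<delta> (basis t) +
    graft (succ_ext \<omega> (basis r) (basis s)) \<gamma> b \<delta> (basis t)"
    by simp
qed (simp_all add: linear_map_def bilinear_ext_linear graft_linear scale_add_right add_ac)

section \<open>The axioms\<close>

lemma Leaf_notin_keys_basis: "T \<noteq> Leaf \<Longrightarrow> Leaf \<notin> Poly_Mapping.keys (basis T)"
  by auto

text \<open>Acting from the left changes only the left branch of the middle tree and the type of its
  edge, acting from the right only the right branch and its type, so the two actions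
  commute.\<close>

lemma prec_ext_succ_ext:
  fixes x y z :: "('d, 'w) tree \<Rightarrow>\<^sub>0 'k::{comm_ring, comm_monoid_mult}"
  assumes "Leaf \<notin> Poly_Mapping.keys y"
  shows "prec_ext \<beta> (succ_ext \<alpha> x y) z = succ_ext \<alpha> x (prec_ext \<beta> y z)"
proof (rule trilinear_eqI[where F = "\<lambda>x y z. prec_ext \<beta> (succ_ext \<alpha> x y) z"
      and G = "\<lambda>x y z. succ_ext \<alpha> x (prec_ext \<beta> y z)"])
  fix T U V :: "('d, 'w) tree" assume "U \<in> Poly_Mapping.keys y"
  then have "U \<noteq> Leaf" using assms by blast
  then obtain Ul \<gamma> b \<delta> Ur where U: "U = Node Ul \<gamma> b \<delta> Ur" by (cases U) auto
  have u: "basis U = graft (basis Ul) \<gamma> b \<delta> (basis Ur)" by (simp add: U)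
  consider "T = Leaf" | "V = Leaf" | "T \<noteq> Leaf" "V \<noteq> Leaf" by blast
  then show "prec_ext \<beta> (succ_ext \<alpha> (basis T) (basis U)) (basis V) =
    succ_ext \<alpha> (basis T) (prec_ext \<beta> (basis U) (basis V))"
    \<comment> \<open>The deleted rules would fold grafts and products of basis elements back into
      trees and \<open>tree_prec\<close> or \<open>tree_succ\<close>, hiding the shapes to which the
      extended recursion applies.\<close>
    by cases (simp_all del: keys_single graft_basis bilinear_ext_basis
        add: u prec_ext_graft succ_ext_graft Leaf_notin_keys_basis Leaf_notin_keys_graft
        bilinear_ext_linear graft_linear)
qed (simp_all add: linear_map_def bilinear_ext_linear)

text \<open>The two axioms are proved together because the induction step of each uses both. The
  middle factor is not taken apart in this induction, so it can stay a fixed linear combination; the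
  types vary because edge types of \<open>T\<close> and \<open>V\<close> enter the smaller
  instances.\<close>

lemma ext_axioms_basis:
  assumes u: "Leaf \<notin> Poly_Mapping.keys u"
  shows "prec_ext \<beta> (prec_ext \<alpha> (basis T) u) (basis V) =
      prec_ext \<alpha> (basis T) (prec_ext \<beta> u (basis V)) +
      prec_ext \<beta> (basis T) (succ_ext \<alpha> u (basis V)) \<and>
    succ_ext \<alpha> (prec_ext \<beta> (basis T) u) (basis V) +
      succ_ext \<beta> (succ_ext \<alpha> (basis T) u) (basis V) =
      succ_ext \<alpha> (basis T) (succ_ext \<beta> u (basis V))"
    (is "?prec_prec \<alpha> \<beta> T V \<and> ?succ_succ \<alpha> \<beta> T V")
proof (induction "vertices T + vertices V" arbitrary: T V \<alpha> \<beta> rule: less_induct)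
  case less
  consider "T = Leaf" | "V = Leaf" | "T \<noteq> Leaf" "V \<noteq> Leaf" by blast
  then show ?case
  proof cases
    case 3
    obtain Tl p a q Tr where T: "T = Node Tl p a q Tr" using 3 by (cases T) auto
    obtain Vl \<gamma> b \<delta> Vr where V: "V = Node Vl \<gamma> b \<delta> Vr" using 3 by (cases V) auto
    have t: "basis T = graft (basis Tl) p a q (basis Tr)" by (simp add: T)
    have v: "basis V = graft (basis Vl) \<gamma> b \<delta> (basis Vr)" by (simp add: V)
    \<comment> \<open>Sort the expanded first axiom by the type of the new right edge: type
      \<open>q\<close> gives the first instance, type \<open>\<beta>\<close> the second, and type
      \<open>\<alpha>\<close> is settled by \<open>prec_ext_succ_ext\<close>.\<close>
    have IHT: "?prec_prec \<alpha> \<beta> Tr V" "?succ_succ q \<alpha> Tr V"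
      using less by (simp_all add: T)
    \<comment> \<open>In the third axiom, sort by the new left edge: type \<open>\<alpha>\<close>
      gives the first instance, type \<open>\<gamma>\<close> the second, and type
      \<open>\<beta>\<close> is again \<open>prec_ext_succ_ext\<close>.\<close>
    have IHV: "?prec_prec \<beta> \<gamma> T Vl" "?succ_succ \<alpha> \<beta> T Vl"
      using less by (simp_all add: V)
    have "?prec_prec \<alpha> \<beta> T V"
      unfolding t using u 3
      by (simp del: keys_single graft_basis bilinear_ext_basis
          add: prec_ext_graft prec_ext_succ_ext bilinear_ext_linear graft_linear
          Leaf_notin_keys_basis IHT(1) IHT(2)[symmetric] algebra_simps)
    moreover have "?succ_succ \<alpha> \<beta> T V"
      unfolding v using u 3
      by (simp del: keys_single graft_basis bilinear_ext_basis
          add: succ_ext_graft prec_ext_succ_ext bilinear_ext_linear graft_linear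
          Leaf_notin_keys_basis IHV(1) IHV(2)[symmetric] algebra_simps)
    ultimately show ?thesis by (rule conjI)
  \<comment> \<open>If \<open>T\<close> is a leaf, the first axiom reads 0 = 0 and both sides of the
    third are \<open>succ_ext \<beta> u (basis V)\<close>. If \<open>V\<close> is a leaf, the third
    reads 0 = 0 and both sides of the first are
    \<open>prec_ext \<alpha> (basis T) u\<close>.\<close>
  qed (simp_all del: bilinear_ext_basis add: u)
qed

lemma prec_ext_prec_ext:
  fixes x y z :: "('d, 'w) tree \<Rightarrow>\<^sub>0 'k::{comm_ring, comm_monoid_mult}"
  assumes "Leaf \<notin> Poly_Mapping.keys y"
  shows "prec_ext \<beta> (prec_ext \<alpha> x y) z =
    prec_ext \<alpha> x (prec_ext \<beta> y z) + prec_ext \<beta> x (succ_ext \<alpha> y z)"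
proof (rule trilinear_eqI[where
      F = "\<lambda>x y z. prec_ext \<beta> (prec_ext \<alpha> x y) z"
      and G = "\<lambda>x y z. prec_ext \<alpha> x (prec_ext \<beta> y z) + prec_ext \<beta> x (succ_ext \<alpha> y z)"])
  fix T U V :: "('d, 'w) tree" assume "U \<in> Poly_Mapping.keys y"
  then have "U \<noteq> Leaf" using assms by blast
  then show "prec_ext \<beta> (prec_ext \<alpha> (basis T) (basis U)) (basis V) =
    prec_ext \<alpha> (basis T) (prec_ext \<beta> (basis U) (basis V)) +
    prec_ext \<beta> (basis T) (succ_ext \<alpha> (basis U) (basis V))"
    by (intro ext_axioms_basis[THEN conjunct1] Leaf_notin_keys_basis)
qed (simp_all add: linear_map_def bilinear_ext_linear scale_add_right add_ac)

lemma succ_ext_succ_ext: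
  fixes x y z :: "('d, 'w) tree \<Rightarrow>\<^sub>0 'k::{comm_ring, comm_monoid_mult}"
  assumes "Leaf \<notin> Poly_Mapping.keys y"
  shows "succ_ext \<alpha> (prec_ext \<beta> x y) z + succ_ext \<beta> (succ_ext \<alpha> x y) z =
    succ_ext \<alpha> x (succ_ext \<beta> y z)"
proof (rule trilinear_eqI[where
      F = "\<lambda>x y z. succ_ext \<alpha> (prec_ext \<beta> x y) z + succ_ext \<beta> (succ_ext \<alpha> x y) z"
      and G = "\<lambda>x y z. succ_ext \<alpha> x (succ_ext \<beta> y z)"])
  fix T U V :: "('d, 'w) tree" assume "U \<in> Poly_Mapping.keys y"
  then have "U \<noteq> Leaf" using assms by blast
  then show "succ_ext \<alpha> (prec_ext \<beta> (basis T) (basis U)) (basis V) +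
    succ_ext \<beta> (succ_ext \<alpha> (basis T) (basis U)) (basis V) =
    succ_ext \<alpha> (basis T) (succ_ext \<beta> (basis U) (basis V))"
    by (intro ext_axioms_basis[THEN conjunct2] Leaf_notin_keys_basis)
qed (simp_all add: linear_map_def bilinear_ext_linear scale_add_right add_ac)

section \<open>Closure\<close>

lemma DD_iff:
  fixes p :: "('d, 'w) tree \<Rightarrow>\<^sub>0 'k::{comm_ring, comm_monoid_mult}"
  shows "p \<in> DD \<longleftrightarrow> Poly_Mapping.keys p \<subseteq> {T. well_typed T \<and> T \<noteq> Leaf}"
proof -
  have "T \<in> (\<Union>n\<in>{1..}. Y n) \<longleftrightarrow> T \<in> {T. well_typed T \<and> T \<noteq> Leaf}" for T :: "('d, 'w) tree"
    by (cases T) (simp_all add: Y_def)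
  then have "(\<Union>n\<in>{1..}. Y n) = {T :: ('d, 'w) tree. well_typed T \<and> T \<noteq> Leaf}"
    by (rule set_eqI)
  then show ?thesis
    by (simp only: DD_def mem_Collect_eq)
qed

lemma Leaf_notin_keys_DD: "p \<in> DD \<Longrightarrow> Leaf \<notin> Poly_Mapping.keys p"
  by (auto simp: DD_iff)

lemma zero_in_DD: "0 \<in> DD"
  by (simp add: DD_iff)

lemma DD_add: "p \<in> DD \<Longrightarrow> q \<in> DD \<Longrightarrow> p + q \<in> DD"
  using Poly_Mapping.keys_add[of p q] unfolding DD_iff by blast

lemma DD_basis: "well_typed T \<Longrightarrow> T \<noteq> Leaf \<Longrightarrow> basis T \<in> DD"
  by (auto simp: DD_iff)

text \<open>Elements of \<open>DD\<close> contain no leaf, so the edge leading to \<open>y\<close>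
  must carry a type in \<Omega>.\<close>

lemma DD_graft:
  assumes "well_typed T" "\<alpha> = None \<longleftrightarrow> T = Leaf" "y \<in> DD" "\<beta> \<noteq> None"
  shows "graft (basis T) \<alpha> a \<beta> y \<in> DD" "graft y \<beta> a \<alpha> (basis T) \<in> DD"
  unfolding DD_iff using assms keys_basis_subset[of T]
  by (intro keys_graft; fastforce simp: DD_iff simp del: keys_single)+

text \<open>An operation of type \<^term>\<open>None\<close> occurs in the recursion only next to a leaf.\<close>
lemma tree_ops_in_DD:
  assumes "well_typed T" "well_typed U" "\<omega> = None \<Longrightarrow> T = Leaf \<or> U = Leaf"
  shows "(tree_prec \<omega> T U :: _ \<Rightarrow>\<^sub>0 'k::{comm_ring, comm_monoid_mult}) \<in> DD"
    and "(tree_succ \<omega> T U :: _ \<Rightarrow>\<^sub>0 'k) \<in> DD"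
  using assms
proof (induction \<omega> T U and \<omega> T U rule: tree_prec_tree_succ.induct)
  case (3 \<omega> Tl \<alpha> a \<beta> Tr Ul \<gamma> b \<delta> Ur)
  let ?U = "Node Ul \<gamma> b \<delta> Ur"
  have *: "well_typed Tl" "\<alpha> = None \<longleftrightarrow> Tl = Leaf" "\<omega> \<noteq> None" "\<beta> = None \<longleftrightarrow> Tr = Leaf"
    using 3 by auto
  \<comment> \<open>If \<open>\<beta>\<close> is \<open>None\<close>, then \<open>Tr\<close> is a
    leaf by well-typedness, which is the side condition of the induction hypothesis.\<close>
  have "(tree_succ \<beta> Tr ?U :: _ \<Rightarrow>\<^sub>0 'k) \<in> DD"
    using 3 by simp
  moreover have "graft (basis Tl) \<alpha> a \<beta> (tree_prec \<omega> Tr ?U :: _ \<Rightarrow>\<^sub>0 'k) \<in> DD"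
  \<comment> \<open>For a leaf \<open>Tr\<close> the type \<open>\<beta>\<close> is
    \<open>None\<close> and \<open>DD_graft\<close> does not apply, but then the product inside the
    graft is 0. The other summand carries \<open>\<omega>\<close>, which is never
    \<open>None\<close> here.\<close>
  proof (cases "Tr = Leaf")
    case False
    then show ?thesis using 3 * by (intro DD_graft(1)) simp_all
  qed (simp add: zero_in_DD)
  ultimately show ?case
    using * by (simp add: DD_add DD_graft(1))
next
  case (6 \<omega> Tl \<alpha> a \<beta> Tr Ul \<gamma> b \<delta> Ur)
  let ?T = "Node Tl \<alpha> a \<beta> Tr"
  have *: "well_typed Ur" "\<delta> = None \<longleftrightarrow> Ur = Leaf" "\<omega> \<noteq> None" "\<gamma> = None \<longleftrightarrow> Ul = Leaf"
    using 6 by auto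
  have "(tree_prec \<gamma> ?T Ul :: _ \<Rightarrow>\<^sub>0 'k) \<in> DD"
    using 6 by simp
  moreover have "graft (tree_succ \<omega> ?T Ul :: _ \<Rightarrow>\<^sub>0 'k) \<gamma> b \<delta> (basis Ur) \<in> DD"
  \<comment> \<open>The mirror image: for a leaf \<open>Ul\<close> the type \<open>\<gamma>\<close>
    is \<open>None\<close> and the grafted product vanishes.\<close>
  proof (cases "Ul = Leaf")
    case False
    then show ?thesis using 6 * by (intro DD_graft(2)) simp_all
  qed (simp add: zero_in_DD)
  ultimately show ?case
    using * by (simp add: DD_add DD_graft(2))
qed (simp_all add: zero_in_DD DD_basis)

theorem proposition3p7:
  "matching_dendriform_algebra
     (DD :: (('d, 'w) tree \<Rightarrow>\<^sub>0 'k::{comm_ring, comm_monoid_mult}) set) scale dd_prec dd_succ"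
proof
  fix x y :: "('d, 'w) tree \<Rightarrow>\<^sub>0 'k" and c :: 'k and \<alpha> :: 'w
  show "scale c x \<in> DD" if "x \<in> DD"
    using that keys_scale_subset[of c x] unfolding DD_iff by blast
  show "dd_prec x \<alpha> y \<in> DD" if "x \<in> DD" "y \<in> DD"
    using that tree_ops_in_DD(1)[where 'k = 'k] unfolding dd_prec_def DD_iff
    by (intro keys_bilinear_ext) blast
  show "dd_succ x \<alpha> y \<in> DD" if "x \<in> DD" "y \<in> DD"
    using that tree_ops_in_DD(2)[where 'k = 'k] unfolding dd_succ_def DD_iff
    by (intro keys_bilinear_ext) blast
\<comment> \<open>The axioms are the instances of the extended ones at types
  \<open>Some \<omega>\<close>; membership of the middle factor in \<open>DD\<close> excludes leaves
  from it.\<close>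
qed (auto simp: dd_prec_def dd_succ_def zero_in_DD DD_add Leaf_notin_keys_DD prec_ext_prec_ext
    prec_ext_succ_ext succ_ext_succ_ext bilinear_ext_linear scale_add_right scale_add_left)

end
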